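(* Let $\{\Gamma_t\}_{t\in[0,t_{max})}$ be a family of closed curves in $\mathbb{R}^3$, given by a parametrization $X : \mathbb{S}^1\times[0,t_{max})\to\mathbb{R}^3$, $\Gamma_t = X(\mathbb{S}^1,t)$, evolving according to the curve shortening flow $$\partial_t X = \partial_s^2 X \ (=\kappa N)\quad\text{on } \mathbb{S}^1\times[0,t_{max}),\qquad X|_{t=0}=X_0,$$ with initial curve $\Gamma_0 = X_0(\mathbb{S}^1)$. Assume that $\Gamma_0$ is a simple spherical curve and that there is a constant $C>0$ such that the curvature satisfies $\kappa(u,t)\le C$ for all $u\in\mathbb{S}^1$ and $t\in[0,t_{max})$. Then $\Gamma_t$ does not intersect itself for any $t\in(0,t_{max})$, i.e. $X(u_1,t)\neq X(u_2,t)$ whenever $u_1\ne u_2$ in $\mathbb{S}^1$ and $t\in(0,t_{max})$.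
   Context: $\mathbb{S}^1=\mathbb{R}/2\pi\mathbb{Z}$. Standing assumptions: $X$ is of class $\mathcal{C}^1$ on $\mathbb{S}^1\times[0,t_{max})$; $X(\cdot,t)$ is of class $\mathcal{C}^2$ for every $t\in[0,t_{max})$; and $\Vert\partial_u X(u,t)\Vert>0$ for all $(u,t)$. In particular $X_0\in\mathcal{C}^2(\mathbb{S}^1;\mathbb{R}^3)$. The arclength derivative is $\partial_s=\Vert\partial_u X\Vert^{-1}\partial_u$, the curvature is $\kappa=\Vert\partial_s^2X\Vert$, and $N=\frac1\kappa\partial_s^2X$ where $\kappa\neq0$; the term $\kappa N=\partial_s^2X$ is defined everywhere. A curve is simple if its parametrization $\mathbb{S}^1\to\mathbb{R}^3$ is injective. A space curve $\Gamma$ is spherical if there exist a point $x\in\mathbb{R}^3$ and a constant $r>0$ such that $\Vert x-y\Vert=r$ for all $y\in\Gamma$. *)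

theory Defs
  imports
    "HOL-Analysis.Analysis"
    "HOL-Library.Periodic_Fun"
    "HOL-Library.Real_Mod"
begin

text \<open>
  The circle is the quotient of the reals by the multiples of \<open>2 * pi\<close>: a map on the circle is a
  \<open>2 * pi\<close>-periodic function on the reals, and two parameters represent the same point of the
  circle iff they are congruent modulo \<open>2 * pi\<close>.
\<close>

text \<open>The end time is an extended real, so that an infinite time interval is allowed.\<close>

definition time_interval :: "ereal \<Rightarrow> real set" where
  "time_interval tmax = {t. 0 \<le> t \<and> ereal t < tmax}"

text \<open>
  In the next definition the time derivative at \<open>t = 0\<close> is the one-sided one, because of
  \<open>at t within T\<close>.
\<close>

definition C1_space_time ::
    "(real \<Rightarrow> real \<Rightarrow> 'a::real_normed_vector) \<Rightarrow> real set \<Rightarrow> bool" where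
  "C1_space_time X T \<longleftrightarrow>
     (\<exists>Xu Xt.
        (\<forall>u. \<forall>t\<in>T. ((\<lambda>v. X v t) has_vector_derivative Xu u t) (at u)) \<and>
        (\<forall>u. \<forall>t\<in>T. ((\<lambda>r. X u r) has_vector_derivative Xt u t) (at t within T)) \<and>
        continuous_on (UNIV \<times> T) (\<lambda>(u, t). Xu u t) \<and>
        continuous_on (UNIV \<times> T) (\<lambda>(u, t). Xt u t))"

definition C2_curve :: "(real \<Rightarrow> 'a::real_normed_vector) \<Rightarrow> bool" where
  "C2_curve \<gamma> \<longleftrightarrow>
     \<gamma> C1_differentiable_on UNIV \<and>
     (\<lambda>u. vector_derivative \<gamma> (at u)) C1_differentiable_on UNIV"

definition regular_curve :: "(real \<Rightarrow> 'a::real_normed_vector) \<Rightarrow> bool" where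
  "regular_curve \<gamma> \<longleftrightarrow> (\<forall>u. norm (vector_derivative \<gamma> (at u)) > 0)"

definition arclength_deriv ::
    "(real \<Rightarrow> 'a::real_normed_vector) \<Rightarrow> (real \<Rightarrow> 'b::real_normed_vector) \<Rightarrow> real \<Rightarrow> 'b" where
  "arclength_deriv \<gamma> f u =
     inverse (norm (vector_derivative \<gamma> (at u))) *\<^sub>R vector_derivative f (at u)"

definition curvature_vector :: "(real \<Rightarrow> 'a::real_normed_vector) \<Rightarrow> real \<Rightarrow> 'a" where
  "curvature_vector \<gamma> = arclength_deriv \<gamma> (arclength_deriv \<gamma> \<gamma>)"

definition curvature :: "(real \<Rightarrow> 'a::real_normed_vector) \<Rightarrow> real \<Rightarrow> real" where
  "curvature \<gamma> u = norm (curvature_vector \<gamma> u)"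

definition simple_on_circle :: "(real \<Rightarrow> 'a) \<Rightarrow> bool" where
  "simple_on_circle \<gamma> \<longleftrightarrow> (\<forall>u1 u2. \<gamma> u1 = \<gamma> u2 \<longrightarrow> [u1 = u2] (rmod (2 * pi)))"

definition spherical :: "'a::real_normed_vector set \<Rightarrow> bool" where
  "spherical \<Gamma> \<longleftrightarrow> (\<exists>x r. r > 0 \<and> (\<forall>y\<in>\<Gamma>. norm (x - y) = r))"

definition curve_shortening_flow ::
    "ereal \<Rightarrow> (real \<Rightarrow> 'a::real_normed_vector) \<Rightarrow> (real \<Rightarrow> real \<Rightarrow> 'a) \<Rightarrow> bool" where
  "curve_shortening_flow tmax X0 X \<longleftrightarrow>
     (\<forall>t\<in>time_interval tmax. periodic_fun_simple (\<lambda>u. X u t) (2 * pi)) \<and>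
     C1_space_time X (time_interval tmax) \<and>
     (\<forall>t\<in>time_interval tmax. C2_curve (\<lambda>u. X u t) \<and> regular_curve (\<lambda>u. X u t)) \<and>
     (\<forall>u. \<forall>t\<in>time_interval tmax.
        ((\<lambda>r. X u r) has_vector_derivative curvature_vector (\<lambda>v. X v t) u)
          (at t within time_interval tmax)) \<and>
     (\<forall>u. X u 0 = X0 u)"

end

theory Submission
  imports Defs
begin

text \<open>
  The function \<open>\<parallel>X - x\<parallel>\<^sup>2 - r\<^sup>2 + 2 t\<close> solves the heat equation along the flow and vanishes
  initially, so \<open>\<Gamma>\<^sub>t\<close> stays on the sphere of squared radius \<open>r\<^sup>2 - 2 t\<close> around \<open>x\<close>. For two
  points of \<open>\<Gamma>\<^sub>t\<close> at a spatial local minimum of their distance, distinct and not antipodal, the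
  difference vector \<open>w\<close> is orthogonal to both unit tangents, which are also tangent to the sphere;
  in three dimensions they therefore agree up to sign. The second derivative test in the direction
  of the tangents then says that the time derivative \<open>2 w \<bullet> (\<kappa>\<^sub>1 N\<^sub>1 - \<kappa>\<^sub>2 N\<^sub>2)\<close> of \<open>\<parallel>w\<parallel>\<^sup>2\<close> is
  nonnegative. Pairs of parameters within a small distance \<open>\<delta>\<close> satisfy a chord bound, uniformly
  on compact time intervals, by uniform continuity of \<open>\<partial>\<^sub>u X\<close>; on the remaining pairs the distance
  stays bounded below by the maximum principle.
\<close>

section \<open>Maximum principle, second derivative test, orthogonality in three dimensions\<close>

text \<open>Subtracting \<open>\<epsilon> * t\<close> makes the time derivative strictly negative at
  a positive space-time maximum, so a larger value occurs shortly before. Spatial information enters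
  only through \<open>deriv\<close>, so \<open>K\<close> needs no differential structure;
  derivatives within \<open>{0..t}\<close> look at past times only and so include the final
  time.\<close>

lemma weak_maximum_principle:
  fixes F :: "'a::topological_space \<Rightarrow> real \<Rightarrow> real"
  assumes "compact K" and T: "0 \<le> T"
    and cont: "continuous_on (K \<times> {0..T}) (\<lambda>(k, t). F k t)"
    and init: "\<And>k. k \<in> K \<Longrightarrow> F k 0 \<le> 0"
    and deriv: "\<And>k t. \<lbrakk>k \<in> K; 0 < t; t \<le> T; F k t > 0; \<And>l. l \<in> K \<Longrightarrow> F l t \<le> F k t\<rbrakk>
      \<Longrightarrow> \<exists>D\<le>0. (F k has_real_derivative D) (at t within {0..t})"
    and k: "k \<in> K" and t: "0 \<le> t" "t \<le> T"
  shows "F k t \<le> 0"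
proof -
  have le: "F k t \<le> \<epsilon> * t" if "\<epsilon> > 0" for \<epsilon>
  proof -
    define G where "G = (\<lambda>(k, t). F k t - \<epsilon> * t)"
    have "continuous_on (K \<times> {0..T}) G"
      using cont unfolding G_def case_prod_unfold by (intro continuous_intros)
    moreover have "compact (K \<times> {0..T})" "K \<times> {0..T} \<noteq> {}"
      using assms by (auto intro: compact_Times)
    ultimately obtain z where z: "z \<in> K \<times> {0..T}" and max: "\<And>y. y \<in> K \<times> {0..T} \<Longrightarrow> G y \<le> G z"
      using continuous_attains_sup by (metis (no_types, lifting))
    obtain l s where ls: "z = (l, s)" by (cases z)
    have l: "l \<in> K" and s: "0 \<le> s" "s \<le> T" using z ls by auto
    have le: "F l' s' - \<epsilon> * s' \<le> F l s - \<epsilon> * s" if "l' \<in> K" "0 \<le> s'" "s' \<le> T" for l' s'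
      using max[of "(l', s')"] that by (simp add: G_def ls)
    have "F l s - \<epsilon> * s \<le> 0"
    proof (rule ccontr)
      assume "\<not> ?thesis"
      then have pos: "F l s > \<epsilon> * s" by simp
      moreover have "\<epsilon> * s \<ge> 0" using that s by simp
      ultimately have "s \<noteq> 0" "F l s > 0" using init[OF l] by auto
      then have "0 < s" using s by simp
      have "F l' s \<le> F l s" if "l' \<in> K" for l' using le[OF that s] by simp
      then obtain D where D: "D \<le> 0" "(F l has_real_derivative D) (at s within {0..s})"
        using deriv l \<open>0 < s\<close> s \<open>F l s > 0\<close> by blast
      have "((\<lambda>r. F l r - \<epsilon> * r) has_real_derivative D - \<epsilon>) (at s within {0..s})"
        using D(2) by (auto intro!: derivative_eq_intros)
      from has_real_derivative_neg_dec_left[OF this] D that obtain d where d: "d > 0"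
        and dec: "\<And>h. 0 < h \<Longrightarrow> s - h \<in> {0..s} \<Longrightarrow> h < d \<Longrightarrow> F l s - \<epsilon> * s < F l (s - h) - \<epsilon> * (s - h)"
        by auto
      define h where "h = min s (d / 2)"
      have "h > 0" "h \<le> s" "h < d" using d \<open>0 < s\<close> by (auto simp: h_def)
      then show False using dec[of h] le[OF l, of "s - h"] s by auto
    qed
    then show ?thesis using le[OF k t] by simp
  qed
  have "F k t \<le> e" if "e > 0" for e
  proof -
    \<comment> \<open>The denominator \<open>t + 1\<close> instead of \<open>t\<close> also covers
      \<open>t = 0\<close>.\<close>
    have "e / (t + 1) > 0" using that t by simp
    from le[OF this] have "F k t \<le> e / (t + 1) * t" .
    also have "\<dots> \<le> e" using that t by (simp add: field_simps)
    finally show ?thesis .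
  qed
  then show ?thesis using field_le_epsilon[of "F k t" 0] by simp
qed

text \<open>If \<open>d < 0\<close>, then \<open>f'\<close> is negative just to the right of
  \<open>a\<close>, and the mean value theorem produces a smaller value of \<open>f\<close>
  there.\<close>

lemma local_min_second_derivative:
  fixes f f' :: "real \<Rightarrow> real"
  assumes f: "\<And>x. (f has_real_derivative f' x) (at x)"
    and f': "(f' has_real_derivative d) (at a)"
    and "\<delta> > 0" and min: "\<And>x. \<bar>x - a\<bar> < \<delta> \<Longrightarrow> f a \<le> f x"
  shows "f' a = 0" "d \<ge> 0"
proof -
  show 0: "f' a = 0"
    using DERIV_local_min[OF f \<open>\<delta> > 0\<close>] min by (simp add: abs_minus_commute)
  show "d \<ge> 0"
  proof (rule ccontr)
    assume "\<not> ?thesis"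
    then obtain e where "e > 0" and e: "\<And>h. 0 < h \<Longrightarrow> h < e \<Longrightarrow> f' (a + h) < f' a"
      using has_real_derivative_neg_dec_right[OF f'] by auto
    define h where "h = min e \<delta> / 2"
    have h: "0 < h" "h < e" "h < \<delta>" using \<open>e > 0\<close> \<open>\<delta> > 0\<close> by (auto simp: h_def min_def)
    from MVT2[of a "a + h" f f'] f h
    obtain z where "a < z" "z < a + h" "f (a + h) - f a = (a + h - a) * f' z"
      by (metis less_add_same_cancel1)
    moreover have "f' z < 0" using e[of "z - a"] 0 calculation h by simp
    ultimately have "f (a + h) < f a" using h mult_pos_neg[of h "f' z"] by simp
    then show False using min[of "a + h"] h by simp
  qed
qed

text \<open>Equal norms make the sum and the difference of two vectors orthogonal. It is applied to
  the unit tangents \<open>a\<close>, \<open>b\<close> and the positions \<open>y\<close>,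
  \<open>z\<close> of two points relative to the centre of the sphere.\<close>

lemma eq_or_minus_if_orthogonal_to_plane:
  fixes a b :: "'a::euclidean_space"
  assumes dim: "DIM('a) = 3" and ab: "norm a = norm b"
    and yz: "norm y = norm z" "y \<noteq> z" "y \<noteq> - z"
    and orth: "a \<bullet> y = 0" "a \<bullet> z = 0" "b \<bullet> y = 0" "b \<bullet> z = 0"
  shows "a = b \<or> a = - b"
proof (rule ccontr)
  assume neg: "\<not> ?thesis"
  \<comment> \<open>otherwise these four vectors are nonzero and pairwise orthogonal\<close>
  define p q r s where pqrs: "p = y - z" "q = y + z" "r = a - b" "s = a + b"
  have n: "p \<noteq> 0" "q \<noteq> 0" "r \<noteq> 0" "s \<noteq> 0"
    using yz(2,3) neg by (auto simp: pqrs add_eq_0_iff2)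
  have ab': "a \<bullet> a = b \<bullet> b" and yz': "y \<bullet> y = z \<bullet> z"
    using ab yz(1) norm_eq by metis+
  have o: "p \<bullet> q = 0" "r \<bullet> s = 0" "r \<bullet> p = 0" "r \<bullet> q = 0" "s \<bullet> p = 0" "s \<bullet> q = 0"
    using ab' yz' orth unfolding pqrs
    by (simp_all add: inner_diff_left inner_diff_right inner_add_left inner_add_right
        inner_commute[of b a] inner_commute[of z y])
  \<comment> \<open>Two of them cannot coincide, as a nonzero vector is not orthogonal to itself;
    the cardinality count below relies on this.\<close>
  have ne: "p \<noteq> q" "r \<noteq> s" "r \<noteq> p" "r \<noteq> q" "s \<noteq> p" "s \<noteq> q"
    using o n by (metis inner_eq_zero_iff)+
  have "pairwise orthogonal {p, q, r, s}"
    unfolding pairwise_insert orthogonal_def using o by (auto simp: inner_commute)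
  then have "independent {p, q, r, s}"
    using n by (intro pairwise_orthogonal_independent) auto
  then have "card {p, q, r, s} \<le> 3"
    using independent_bound[of "{p, q, r, s}"] dim by simp
  moreover have "card {p, q, r, s} = 4"
    using ne ne[symmetric] by simp
  ultimately show False by simp
qed

section \<open>The curvature vector at extrema of distances\<close>

text \<open>Differentiating the factor \<open>inverse (norm (\<gamma>' u))\<close> contributes only
  a tangential term. Its coefficient \<open>\<beta>\<close> stays unspecified because it is paired
  below only with vectors normal to the curve.\<close>

lemma C2_regular_curve_derivatives:
  fixes \<gamma> :: "real \<Rightarrow> 'a::real_inner"
  assumes "C2_curve \<gamma>" "regular_curve \<gamma>"
  obtains \<gamma>' \<gamma>'' \<beta> where
    "\<And>u. (\<gamma> has_vector_derivative \<gamma>' u) (at u)"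
    "\<And>u. (\<gamma>' has_vector_derivative \<gamma>'' u) (at u)"
    "\<And>u. \<gamma>' u \<noteq> 0"
    "\<And>u. curvature_vector \<gamma> u = inverse ((norm (\<gamma>' u))\<^sup>2) *\<^sub>R \<gamma>'' u + \<beta> u *\<^sub>R \<gamma>' u"
proof -
  define \<gamma>' where "\<gamma>' = (\<lambda>u. vector_derivative \<gamma> (at u))"
  define \<gamma>'' where "\<gamma>'' = (\<lambda>u. vector_derivative \<gamma>' (at u))"
  have 1: "(\<gamma> has_vector_derivative \<gamma>' u) (at u)" and 2: "(\<gamma>' has_vector_derivative \<gamma>'' u) (at u)" for u
    using assms(1) unfolding C2_curve_def C1_differentiable_on_eq \<gamma>'_def[symmetric]
    by (auto simp: vector_derivative_works \<gamma>'_def \<gamma>''_def)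
  have nz: "\<gamma>' u \<noteq> 0" for u
    using assms(2) by (auto simp: regular_curve_def \<gamma>'_def)
  have "\<exists>c. curvature_vector \<gamma> u = inverse ((norm (\<gamma>' u))\<^sup>2) *\<^sub>R \<gamma>'' u + c *\<^sub>R \<gamma>' u" for u
  proof -
    have "\<gamma>' differentiable (at u)"
      using 2 by (rule differentiableI_vector)
    then have "(\<lambda>v. norm (\<gamma>' v)) differentiable (at u)"
      using differentiable_compose[of norm \<gamma>' u UNIV] nz by auto
    then have "(\<lambda>v. inverse (norm (\<gamma>' v))) differentiable (at u)"
      using nz by (intro differentiable_inverse) auto
    then obtain c where c: "((\<lambda>v. inverse (norm (\<gamma>' v))) has_real_derivative c) (at u)"
      using real_differentiable_def by auto
    have "((\<lambda>v. inverse (norm (\<gamma>' v)) *\<^sub>R \<gamma>' v) has_vector_derivative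
        inverse (norm (\<gamma>' u)) *\<^sub>R \<gamma>'' u + c *\<^sub>R \<gamma>' u) (at u)"
      using c 2 by (rule has_vector_derivative_scaleR)
    then have "curvature_vector \<gamma> u =
        inverse (norm (\<gamma>' u)) *\<^sub>R (inverse (norm (\<gamma>' u)) *\<^sub>R \<gamma>'' u + c *\<^sub>R \<gamma>' u)"
      unfolding curvature_vector_def arclength_deriv_def \<gamma>'_def[symmetric]
      by (simp add: vector_derivative_at \<gamma>'_def)
    then show ?thesis
      by (intro exI[of _ "inverse (norm (\<gamma>' u)) * c"]) (simp add: scaleR_add_right power2_eq_square)
  qed
  then obtain \<beta> where "\<And>u. curvature_vector \<gamma> u = inverse ((norm (\<gamma>' u))\<^sup>2) *\<^sub>R \<gamma>'' u + \<beta> u *\<^sub>R \<gamma>' u"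
    by metis
  with 1 2 nz show ?thesis using that by blast
qed

text \<open>The factor \<open>c\<close> treats minima (\<open>c > 0\<close>) and maxima
  (\<open>c < 0\<close>) at once. The first-order condition removes the tangential term, and the 1
  is the squared speed divided by itself.\<close>

lemma curvature_vector_at_distance_extremum:
  fixes \<gamma> :: "real \<Rightarrow> 'a::real_inner"
  assumes "C2_curve \<gamma>" "regular_curve \<gamma>"
    and min: "\<And>v. c * (norm (\<gamma> u - x))\<^sup>2 \<le> c * (norm (\<gamma> v - x))\<^sup>2"
  shows "c * ((\<gamma> u - x) \<bullet> curvature_vector \<gamma> u + 1) \<ge> 0"
proof -
  obtain \<gamma>' \<gamma>'' \<beta> where
    d1: "\<And>u. (\<gamma> has_vector_derivative \<gamma>' u) (at u)" and
    d2: "\<And>u. (\<gamma>' has_vector_derivative \<gamma>'' u) (at u)" and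
    nz: "\<And>u. \<gamma>' u \<noteq> 0" and
    k: "\<And>u. curvature_vector \<gamma> u = inverse ((norm (\<gamma>' u))\<^sup>2) *\<^sub>R \<gamma>'' u + \<beta> u *\<^sub>R \<gamma>' u"
    using C2_regular_curve_derivatives[OF assms(1,2)] by blast
  let ?f = "\<lambda>v. c * ((\<gamma> v - x) \<bullet> (\<gamma> v - x))"
  let ?f' = "\<lambda>v. 2 * c * ((\<gamma> v - x) \<bullet> \<gamma>' v)"
  have y: "((\<lambda>v. \<gamma> v - x) has_vector_derivative \<gamma>' v) (at v)" for v
    using d1 by (auto intro!: derivative_eq_intros)
  note inner = bounded_bilinear.has_vector_derivative[OF bounded_bilinear_inner,
      folded has_real_derivative_iff_has_vector_derivative]
  have f: "(?f has_real_derivative ?f' v) (at v)" for v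
    using DERIV_cmult[OF inner[OF y y]] by (simp add: inner_commute algebra_simps)
  have f': "(?f' has_real_derivative 2 * c * ((\<gamma> u - x) \<bullet> \<gamma>'' u + \<gamma>' u \<bullet> \<gamma>' u)) (at u)"
    using DERIV_cmult[OF inner[OF y d2]] .
  have le: "?f u \<le> ?f v" for v
    using min[of v] by (simp add: dot_square_norm)
  from local_min_second_derivative[OF f f' zero_less_one le]
  have 1: "c * ((\<gamma> u - x) \<bullet> \<gamma>' u) = 0" and 2: "c * ((\<gamma> u - x) \<bullet> \<gamma>'' u + \<gamma>' u \<bullet> \<gamma>' u) \<ge> 0"
    by simp_all
  have "c * ((\<gamma> u - x) \<bullet> curvature_vector \<gamma> u + 1) =
      inverse ((norm (\<gamma>' u))\<^sup>2) * (c * ((\<gamma> u - x) \<bullet> \<gamma>'' u + \<gamma>' u \<bullet> \<gamma>' u))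
      + \<beta> u * (c * ((\<gamma> u - x) \<bullet> \<gamma>' u))"
    using nz[of u] unfolding k
    by (simp add: inner_add_right algebra_simps power2_norm_eq_inner)
  also have "\<dots> \<ge> 0"
    unfolding 1 using mult_nonneg_nonneg[OF _ 2, of "inverse ((norm (\<gamma>' u))\<^sup>2)"] by simp
  finally show ?thesis .
qed

text \<open>The bound \<open>lt\<close> excludes antipodal points, whose position vectors are
  parallel and do not determine a common tangent direction.\<close>

lemma curvature_vector_at_local_min_distance:
  fixes \<gamma> :: "real \<Rightarrow> 'a::euclidean_space"
  assumes "DIM('a) = 3" "C2_curve \<gamma>" "regular_curve \<gamma>"
    and sphere: "\<And>u. norm (\<gamma> u - x) = \<rho>"
    and "d > 0" and min: "\<And>u v. \<bar>u - p\<bar> < d \<Longrightarrow> \<bar>v - q\<bar> < d \<Longrightarrow> norm (\<gamma> p - \<gamma> q) \<le> norm (\<gamma> u - \<gamma> v)"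
    and lt: "norm (\<gamma> p - \<gamma> q) < 2 * \<rho>"
  shows "(\<gamma> p - \<gamma> q) \<bullet> (curvature_vector \<gamma> p - curvature_vector \<gamma> q) \<ge> 0"
proof (cases "\<gamma> p = \<gamma> q")
  case False
  obtain \<gamma>' \<gamma>'' \<beta> where
    d1: "\<And>u. (\<gamma> has_vector_derivative \<gamma>' u) (at u)" and
    d2: "\<And>u. (\<gamma>' has_vector_derivative \<gamma>'' u) (at u)" and
    nz: "\<And>u. \<gamma>' u \<noteq> 0" and
    k: "\<And>u. curvature_vector \<gamma> u = inverse ((norm (\<gamma>' u))\<^sup>2) *\<^sub>R \<gamma>'' u + \<beta> u *\<^sub>R \<gamma>' u"
    using C2_regular_curve_derivatives[OF assms(2,3)] by blast
  note inner = bounded_bilinear.has_vector_derivative[OF bounded_bilinear_inner,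
      folded has_real_derivative_iff_has_vector_derivative]
  define w where "w = \<gamma> p - \<gamma> q"
  have tangent: "(\<gamma> u - x) \<bullet> \<gamma>' u = 0" for u
  proof -
    have "((\<lambda>v. \<gamma> v - x) has_vector_derivative \<gamma>' u) (at u)"
      using d1 by (auto intro!: derivative_eq_intros)
    from inner[OF this this]
    have "((\<lambda>v. (\<gamma> v - x) \<bullet> (\<gamma> v - x)) has_real_derivative 2 * ((\<gamma> u - x) \<bullet> \<gamma>' u)) (at u)"
      by (simp add: inner_commute)
    moreover have "(\<lambda>v. (\<gamma> v - x) \<bullet> (\<gamma> v - x)) = (\<lambda>v. \<rho>\<^sup>2)"
      using sphere by (simp add: dot_square_norm)
    ultimately have "((\<lambda>v. \<rho>\<^sup>2) has_real_derivative 2 * ((\<gamma> u - x) \<bullet> \<gamma>' u)) (at u)"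
      by metis
    from DERIV_unique[OF this DERIV_const] show ?thesis by simp
  qed
  \<comment> \<open>First and second variation of the squared distance when the two parameters move
    with arbitrary constant speeds \<open>a\<close> and \<open>b\<close>.\<close>
  have test: "w \<bullet> (a *\<^sub>R \<gamma>' p - b *\<^sub>R \<gamma>' q) = 0"
    "(norm (a *\<^sub>R \<gamma>' p - b *\<^sub>R \<gamma>' q))\<^sup>2 + w \<bullet> (a\<^sup>2 *\<^sub>R \<gamma>'' p - b\<^sup>2 *\<^sub>R \<gamma>'' q) \<ge> 0" for a b
  proof -
    define W where "W = (\<lambda>\<sigma>. \<gamma> (p + a * \<sigma>) - \<gamma> (q + b * \<sigma>))"
    define W' where "W' = (\<lambda>\<sigma>. a *\<^sub>R \<gamma>' (p + a * \<sigma>) - b *\<^sub>R \<gamma>' (q + b * \<sigma>))"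
    define W'' where "W'' = (\<lambda>\<sigma>. a\<^sup>2 *\<^sub>R \<gamma>'' (p + a * \<sigma>) - b\<^sup>2 *\<^sub>R \<gamma>'' (q + b * \<sigma>))"
    have chain: "((\<lambda>\<sigma>. g (r + c * \<sigma>)) has_vector_derivative c *\<^sub>R g' (r + c * \<sigma>)) (at \<sigma>)"
      if "\<And>u. (g has_vector_derivative g' u) (at u)" for g g' :: "real \<Rightarrow> 'a" and r c \<sigma>
    proof -
      have "((\<lambda>\<sigma>. r + c * \<sigma>) has_real_derivative c) (at \<sigma>)"
        by (auto intro!: derivative_eq_intros)
      then show ?thesis
        using vector_diff_chain_at[of "\<lambda>\<sigma>. r + c * \<sigma>" c \<sigma> g] that
        by (simp add: has_real_derivative_iff_has_vector_derivative o_def)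
    qed
    have W: "(W has_vector_derivative W' \<sigma>) (at \<sigma>)" for \<sigma>
      unfolding W_def W'_def by (intro has_vector_derivative_diff chain d1)
    have "((\<lambda>\<sigma>. c *\<^sub>R \<gamma>' (r + c * \<sigma>)) has_vector_derivative c\<^sup>2 *\<^sub>R \<gamma>'' (r + c * \<sigma>)) (at \<sigma>)" for c r \<sigma>
      using bounded_linear.has_vector_derivative[OF bounded_linear_scaleR_right chain[OF d2]]
      by (simp add: power2_eq_square)
    then have W': "(W' has_vector_derivative W'' \<sigma>) (at \<sigma>)" for \<sigma>
      unfolding W'_def W''_def by (intro has_vector_derivative_diff)
    let ?f = "\<lambda>\<sigma>. W \<sigma> \<bullet> W \<sigma>" and ?f' = "\<lambda>\<sigma>. 2 * (W \<sigma> \<bullet> W' \<sigma>)"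
    have f: "(?f has_real_derivative ?f' \<sigma>) (at \<sigma>)" for \<sigma>
      using inner[OF W W] by (simp add: inner_commute)
    have f': "(?f' has_real_derivative 2 * (W 0 \<bullet> W'' 0 + W' 0 \<bullet> W' 0)) (at 0)"
      by (intro DERIV_cmult inner W W')
    \<comment> \<open>This keeps both parameter shifts below \<open>d\<close>; the summand 1 covers
      \<open>a = b = 0\<close>.\<close>
    define \<delta> where "\<delta> = d / (1 + \<bar>a\<bar> + \<bar>b\<bar>)"
    have pos: "1 + \<bar>a\<bar> + \<bar>b\<bar> > 0" by simp
    have "\<delta> > 0" using \<open>d > 0\<close> pos by (simp add: \<delta>_def)
    have le: "?f 0 \<le> ?f \<sigma>" if "\<bar>\<sigma> - 0\<bar> < \<delta>" for \<sigma>
    proof -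
      have "\<bar>\<sigma>\<bar> * (1 + \<bar>a\<bar> + \<bar>b\<bar>) < d"
        using that pos by (simp add: \<delta>_def less_divide_eq)
      moreover have "\<bar>\<sigma>\<bar> * (1 + \<bar>a\<bar> + \<bar>b\<bar>) = \<bar>\<sigma>\<bar> + \<bar>a * \<sigma>\<bar> + \<bar>b * \<sigma>\<bar>"
        by (simp add: abs_mult algebra_simps)
      ultimately have "\<bar>a * \<sigma>\<bar> < d" "\<bar>b * \<sigma>\<bar> < d" by linarith+
      then have "norm (\<gamma> p - \<gamma> q) \<le> norm (W \<sigma>)"
        unfolding W_def by (intro min) auto
      then show ?thesis by (simp add: W_def norm_le)
    qed
    from local_min_second_derivative[OF f f' \<open>\<delta> > 0\<close> le]
    show "w \<bullet> (a *\<^sub>R \<gamma>' p - b *\<^sub>R \<gamma>' q) = 0"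
      "(norm (a *\<^sub>R \<gamma>' p - b *\<^sub>R \<gamma>' q))\<^sup>2 + w \<bullet> (a\<^sup>2 *\<^sub>R \<gamma>'' p - b\<^sup>2 *\<^sub>R \<gamma>'' q) \<ge> 0"
      by (simp_all add: W_def W'_def W''_def w_def power2_norm_eq_inner)
  qed
  have wp: "w \<bullet> \<gamma>' p = 0" and wq: "w \<bullet> \<gamma>' q = 0"
    using test(1)[of 1 0] test(1)[of 0 1] by simp_all
  \<comment> \<open>Both tangents are orthogonal to \<open>\<gamma> p - x\<close> and \<open>\<gamma> q - x\<close>. Moving the two points at unit speed
    in the parallel directions keeps their velocity difference zero, so that the second derivative
    of the squared distance reduces to the curvature term.\<close>
  define Tp Tq where "Tp = \<gamma>' p /\<^sub>R norm (\<gamma>' p)" and "Tq = \<gamma>' q /\<^sub>R norm (\<gamma>' q)"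
  have "Tp = Tq \<or> Tp = - Tq"
  proof (rule eq_or_minus_if_orthogonal_to_plane[OF assms(1)])
    show "norm Tp = norm Tq" using nz by (simp add: Tp_def Tq_def)
    show "norm (\<gamma> p - x) = norm (\<gamma> q - x)" using sphere by simp
    show "\<gamma> p - x \<noteq> \<gamma> q - x" using False by simp
    show "\<gamma> p - x \<noteq> - (\<gamma> q - x)"
    proof
      assume "\<gamma> p - x = - (\<gamma> q - x)"
      then have "\<gamma> p - \<gamma> q = 2 *\<^sub>R (\<gamma> p - x)" by (simp add: scaleR_2 algebra_simps)
      then have "norm (\<gamma> p - \<gamma> q) = 2 * \<rho>" using sphere by simp
      then show False using lt by simp
    qed
    \<comment> \<open>A tangent is orthogonal to its own position vector by \<open>tangent\<close>,
      and to the other one because the two differ by \<open>w\<close>.\<close>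
    have "(\<gamma> p - x) \<bullet> \<gamma>' q = w \<bullet> \<gamma>' q + (\<gamma> q - x) \<bullet> \<gamma>' q"
      "(\<gamma> q - x) \<bullet> \<gamma>' p = (\<gamma> p - x) \<bullet> \<gamma>' p - w \<bullet> \<gamma>' p"
      by (simp_all add: w_def inner_diff_left)
    then show "Tp \<bullet> (\<gamma> p - x) = 0" "Tp \<bullet> (\<gamma> q - x) = 0" "Tq \<bullet> (\<gamma> p - x) = 0" "Tq \<bullet> (\<gamma> q - x) = 0"
      using tangent wp wq by (simp_all add: Tp_def Tq_def inner_commute)
  qed
  then obtain b where b: "b = inverse (norm (\<gamma>' q)) \<or> b = - inverse (norm (\<gamma>' q))" "Tp = b *\<^sub>R \<gamma>' q"
    unfolding Tq_def by (metis scaleR_minus_left)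
  \<comment> \<open>The sign of \<open>b\<close> makes the velocities cancel, and it disappears in
    the square of \<open>b\<close>.\<close>
  have "w \<bullet> (inverse ((norm (\<gamma>' p))\<^sup>2) *\<^sub>R \<gamma>'' p - inverse ((norm (\<gamma>' q))\<^sup>2) *\<^sub>R \<gamma>'' q) \<ge> 0"
    using test(2)[of "inverse (norm (\<gamma>' p))" b] b
    by (auto simp: Tp_def power_inverse)
  then show ?thesis
    unfolding k using wp wq
    by (simp add: w_def[symmetric] inner_diff_right inner_add_right)
qed simp

section \<open>Joint continuity and chord bounds in space-time\<close>

text \<open>Partial derivatives alone do not give joint continuity; the continuity of
  \<open>Xt\<close> on a convex set of times upgrades them to a total derivative.\<close>

lemma C1_space_time_continuous_on:
  assumes X: "C1_space_time X T" and "convex T"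
  shows "continuous_on (UNIV \<times> T) (\<lambda>(u, t). X u t)"
proof -
  obtain Xu Xt where
    Xu: "\<And>u t. t \<in> T \<Longrightarrow> ((\<lambda>v. X v t) has_vector_derivative Xu u t) (at u)" and
    Xt: "\<And>u t. t \<in> T \<Longrightarrow> ((\<lambda>r. X u r) has_vector_derivative Xt u t) (at t within T)" and
    cont: "continuous_on (UNIV \<times> T) (\<lambda>(u, t). Xt u t)"
    using X unfolding C1_space_time_def by blast
  have "((\<lambda>(u, t). X u t) has_derivative
      (\<lambda>(tu, tt). tu *\<^sub>R Xu u t + blinfun_scaleR_left (Xt u t) tt)) (at (u, t) within UNIV \<times> T)"
    if "t \<in> T" for u t
  proof (rule has_derivative_partialsI)
    show "((\<lambda>v. X v t) has_derivative (\<lambda>tu. tu *\<^sub>R Xu u t)) (at u within UNIV)"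
      using Xu[OF that] by (simp add: has_vector_derivative_def)
    show "((\<lambda>r. X v r) has_derivative blinfun_apply (blinfun_scaleR_left (Xt v s))) (at s within T)"
      if "s \<in> T" for v s
      using Xt[OF that] by (simp add: has_vector_derivative_def)
    have "continuous_on (UNIV \<times> T) (\<lambda>(u, t). blinfun_scaleR_left (Xt u t))"
      using cont unfolding case_prod_unfold by (intro continuous_intros)
    then show "continuous (at (u, t) within UNIV \<times> T) (\<lambda>(u, t). blinfun_scaleR_left (Xt u t))"
      using that by (simp add: continuous_on_eq_continuous_within)
  qed (use that \<open>convex T\<close> in auto)
  then show ?thesis
    unfolding continuous_on_eq_continuous_within by (auto intro: has_derivative_continuous)
qed

text \<open>With \<open>a\<close> half the least speed on the compact set, uniform continuity keeps
  the velocity within \<open>a\<close> of its value at \<open>u\<close> along a short parameter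
  segment. The displacement then deviates from \<open>(v - u) *\<^sub>R Xu u t\<close> by at most
  half of that vector's length.\<close>

lemma C1_space_time_chord_bound:
  assumes X: "C1_space_time X T" and reg: "\<And>t. t \<in> T \<Longrightarrow> regular_curve (\<lambda>u. X u t)"
    and "S \<subseteq> T" "compact S"
  obtains a \<delta> where "a > 0" "\<delta> > 0"
    "\<And>u v t. \<lbrakk>u \<in> {A..B}; v \<in> {A..B}; t \<in> S; \<bar>v - u\<bar> < \<delta>\<rbrakk> \<Longrightarrow> a * \<bar>v - u\<bar> \<le> norm (X v t - X u t)"
proof (cases "{A..B} \<times> S = {}")
  case True
  then show ?thesis using that[of 1 1] by auto
next
  case False
  obtain Xu where
    Xu: "\<And>u t. t \<in> T \<Longrightarrow> ((\<lambda>v. X v t) has_vector_derivative Xu u t) (at u)" and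
    cont: "continuous_on (UNIV \<times> T) (\<lambda>(u, t). Xu u t)"
    using X unfolding C1_space_time_def by blast
  define Y where "Y = (\<lambda>(u, t). Xu u t)"
  let ?K = "{A..B} \<times> S"
  have K: "compact ?K" using \<open>compact S\<close> by (intro compact_Times) auto
  have cY: "continuous_on ?K Y"
    unfolding Y_def by (rule continuous_on_subset[OF cont]) (use \<open>S \<subseteq> T\<close> in auto)
  have "continuous_on ?K (\<lambda>z. norm (Y z))" using cY by (intro continuous_intros)
  from continuous_attains_inf[OF K False this]
  obtain z where z: "z \<in> ?K" "\<And>y. y \<in> ?K \<Longrightarrow> norm (Y z) \<le> norm (Y y)" by blast
  obtain u0 t0 where ut: "z = (u0, t0)" by (cases z)
  have "Xu u0 t0 = vector_derivative (\<lambda>v. X v t0) (at u0)"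
    using Xu[of t0 u0] z ut \<open>S \<subseteq> T\<close> by (auto simp: vector_derivative_at)
  then have pos: "norm (Y z) > 0"
    using reg[of t0] z ut \<open>S \<subseteq> T\<close> by (auto simp: Y_def regular_curve_def)
  define a where "a = norm (Y z) / 2"
  have "a > 0" using pos by (simp add: a_def)
  obtain \<delta> where "\<delta> > 0" and \<delta>: "\<And>y y'. y \<in> ?K \<Longrightarrow> y' \<in> ?K \<Longrightarrow> dist y' y < \<delta> \<Longrightarrow> dist (Y y') (Y y) < a"
    using compact_uniformly_continuous[OF cY K] \<open>a > 0\<close> unfolding uniformly_continuous_on_def by metis
  have "a * \<bar>v - u\<bar> \<le> norm (X v t - X u t)"
    if "u \<in> {A..B}" "v \<in> {A..B}" "t \<in> S" "\<bar>v - u\<bar> < \<delta>" for u v t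
  proof -
    have "norm (X v t - X u t - (v - u) *\<^sub>R Xu u t) \<le> norm (v - u) * a"
    proof (rule vector_differentiable_bound_linearization[where S = "closed_segment u v" and a = u and b = v
          and f = "\<lambda>v. X v t" and f' = "\<lambda>u. Xu u t" and ?x0.0 = u])
      show "((\<lambda>v. X v t) has_vector_derivative Xu x t) (at x within closed_segment u v)" for x
        using Xu[of t x] that \<open>S \<subseteq> T\<close> by (auto intro: has_vector_derivative_at_within)
      show "norm (Xu x t - Xu u t) \<le> a" if x: "x \<in> closed_segment u v" for x
      proof -
        have "x \<in> {A..B}"
          using x \<open>u \<in> {A..B}\<close> \<open>v \<in> {A..B}\<close> by (auto simp: closed_segment_eq_real_ivl split: if_splits)
        moreover have "\<bar>x - u\<bar> < \<delta>"
          using x \<open>\<bar>v - u\<bar> < \<delta>\<close> by (auto simp: closed_segment_eq_real_ivl split: if_splits)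
        ultimately show ?thesis
          using \<delta>[of "(u, t)" "(x, t)"] \<open>u \<in> {A..B}\<close> \<open>t \<in> S\<close> by (simp add: Y_def dist_Pair_Pair dist_norm)
      qed
    qed auto
    moreover have "2 * a \<le> norm (Xu u t)"
      using z(2)[of "(u, t)"] that by (simp add: a_def Y_def)
    then have "\<bar>v - u\<bar> * (2 * a) \<le> norm ((v - u) *\<^sub>R Xu u t)"
      by (simp add: mult_left_mono)
    moreover have "norm ((v - u) *\<^sub>R Xu u t) \<le> norm (X v t - X u t) + norm (X v t - X u t - (v - u) *\<^sub>R Xu u t)"
      using norm_triangle_sub[of "(v - u) *\<^sub>R Xu u t" "X v t - X u t"] by (simp add: norm_minus_commute)
    ultimately show ?thesis by (simp add: algebra_simps)
  qed
  with \<open>a > 0\<close> \<open>\<delta> > 0\<close> show ?thesis using that by blast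
qed

section \<open>Time intervals and reduction modulo the period\<close>

lemma convex_time_interval: "convex (time_interval tmax)"
  unfolding is_interval_convex_1[symmetric] is_interval_1 time_interval_def
  by (auto intro: le_less_trans[of "ereal _" "ereal _"])

lemma atLeastAtMost_subset_time_interval: "t \<in> time_interval tmax \<Longrightarrow> {0..t} \<subseteq> time_interval tmax"
  by (auto simp: time_interval_def intro: le_less_trans[of "ereal _" "ereal _"])

text \<open>The shift \<open>v\<close> allows the first parameter of a pair to be reduced while the
  gap to the second is kept.\<close>

lemma periodic_fun_simple_rmod_add:
  assumes "periodic_fun_simple f p"
  shows "f (u rmod p + v) = f (u + v)"
proof -
  interpret periodic_fun_simple f p by fact
  obtain n where "u rmod p = u + of_int n * p"
    using rcong_altdef[of u "u rmod p" p] by auto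
  then show ?thesis
    using plus_of_int[of "u + v" n] by (simp add: algebra_simps)
qed

section \<open>The flow stays on shrinking concentric spheres\<close>

text \<open>The maximum principle is applied to \<open>c\<close> times the defect of the identity.
  At a spatial maximum the extremum lemma with factor \<open>- c\<close> gives the sign of the time
  derivative.\<close>

lemma curve_shortening_flow_sphere:
  fixes X :: "real \<Rightarrow> real \<Rightarrow> 'a::real_inner"
  assumes flow: "curve_shortening_flow tmax X0 X"
    and sphere: "\<And>u. norm (X0 u - x) = r"
    and t: "t \<in> time_interval tmax"
  shows "(norm (X u t - x))\<^sup>2 = r\<^sup>2 - 2 * t"
proof -
  let ?I = "time_interval tmax"
  have per: "periodic_fun_simple (\<lambda>u. X u s) (2 * pi)" and C2: "C2_curve (\<lambda>u. X u s)"
    and reg: "regular_curve (\<lambda>u. X u s)"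
    and dt: "((\<lambda>r. X u r) has_vector_derivative curvature_vector (\<lambda>v. X v s) u) (at s within ?I)"
    if "s \<in> ?I" for s u
    using flow that unfolding curve_shortening_flow_def by blast+
  have sub: "{0..t} \<subseteq> ?I" using t by (rule atLeastAtMost_subset_time_interval)
  have cont: "continuous_on (UNIV \<times> ?I) (\<lambda>(u, t). X u t)"
    using flow convex_time_interval unfolding curve_shortening_flow_def
    by (intro C1_space_time_continuous_on) auto
  have rmod: "X (u rmod (2 * pi)) s = X u s" if "s \<in> ?I" for u s
    using periodic_fun_simple_rmod_add[OF per[OF that], of u 0] by simp
  have rmod_in: "u rmod (2 * pi) \<in> {0..2 * pi}" for u
    using rmod_nonneg[of "2 * pi" u] rmod_le[of "2 * pi" u] by simp
  have le: "c * ((norm (X u t - x))\<^sup>2 - r\<^sup>2 + 2 * t) \<le> 0" if "u \<in> {0..2 * pi}" for c u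
  proof (rule weak_maximum_principle[where K = "{0..2 * pi}" and T = t and k = u and t = t and
        F = "\<lambda>u s. c * ((norm (X u s - x))\<^sup>2 - r\<^sup>2 + 2 * s)"])
    have "continuous_on ({0..2 * pi} \<times> {0..t}) (\<lambda>(u, t). X u t)"
      using cont by (rule continuous_on_subset) (use sub in auto)
    then show "continuous_on ({0..2 * pi} \<times> {0..t}) (\<lambda>(u, s). c * ((norm (X u s - x))\<^sup>2 - r\<^sup>2 + 2 * s))"
      unfolding case_prod_unfold by (intro continuous_intros)
    show "c * ((norm (X v 0 - x))\<^sup>2 - r\<^sup>2 + 2 * 0) \<le> 0" for v
      using flow sphere by (simp add: curve_shortening_flow_def)
    fix v s
    let ?F = "\<lambda>u s. c * ((norm (X u s - x))\<^sup>2 - r\<^sup>2 + 2 * s)"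
    assume s: "0 < s" "s \<le> t" and max: "\<And>l. l \<in> {0..2 * pi} \<Longrightarrow> ?F l s \<le> ?F v s"
    have sI: "s \<in> ?I" and sub': "{0..s} \<subseteq> ?I" using s sub by auto
    let ?k = "curvature_vector (\<lambda>v. X v s) v"
    \<comment> \<open>By periodicity the maximum over one period is global, so an endpoint of
      \<open>{0..2 * pi}\<close> needs no separate treatment.\<close>
    have "?F l s \<le> ?F v s" for l
      using max[OF rmod_in[of l]] rmod[OF sI] by simp
    then have "- c * (norm (X v s - x))\<^sup>2 \<le> - c * (norm (X l s - x))\<^sup>2" for l
      by (simp add: algebra_simps)
    from curvature_vector_at_distance_extremum[OF C2[OF sI] reg[OF sI] this]
    have "c * ((X v s - x) \<bullet> ?k + 1) \<le> 0" by simp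
    moreover have "((\<lambda>r. X v r - x) has_vector_derivative ?k) (at s within {0..s})"
      using has_vector_derivative_within_subset[OF dt[OF sI] sub']
      by (auto intro!: derivative_eq_intros)
    from bounded_bilinear.has_vector_derivative[OF bounded_bilinear_inner this this]
    have "((\<lambda>r. (norm (X v r - x))\<^sup>2) has_real_derivative 2 * ((X v s - x) \<bullet> ?k)) (at s within {0..s})"
      by (simp add: has_real_derivative_iff_has_vector_derivative inner_commute power2_norm_eq_inner)
    from DERIV_cmult[OF DERIV_add[OF DERIV_diff[OF this DERIV_const] DERIV_cmult_Id]]
    have "(?F v has_real_derivative 2 * (c * ((X v s - x) \<bullet> ?k + 1))) (at s within {0..s})"
      by (rule DERIV_cong) (simp add: algebra_simps)
    ultimately show "\<exists>D\<le>0. (?F v has_real_derivative D) (at s within {0..s})"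
      by (intro exI conjI) auto
  qed (use t that in \<open>auto simp: time_interval_def\<close>)
  \<comment> \<open>The two signs of \<open>c\<close> bound the defect from above and from
    below.\<close>
  from le[OF rmod_in[of u], of 1] le[OF rmod_in[of u], of "-1"] rmod[OF t]
  show ?thesis by simp
qed

section \<open>Distances between points of the evolving curve\<close>

theorem proposition2:
  fixes X :: "real \<Rightarrow> real \<Rightarrow> real ^ 3"
    and X0 :: "real \<Rightarrow> real ^ 3"
    and tmax :: ereal
    and C :: real
  assumes tmax_pos: "0 < tmax"
    and flow: "curve_shortening_flow tmax X0 X"
    and simple: "simple_on_circle X0"
    and spherical: "spherical (range X0)"
    and C_pos: "C > 0"
    and curvature_bound: "\<forall>u. \<forall>t\<in>time_interval tmax. curvature (\<lambda>v. X v t) u \<le> C"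
  shows "\<forall>t u1 u2. 0 < t \<and> ereal t < tmax \<and> \<not> [u1 = u2] (rmod (2 * pi))
           \<longrightarrow> X u1 t \<noteq> X u2 t"
proof (intro allI impI, elim conjE)
  fix T u1 u2
  assume "0 < T" "ereal T < tmax" and u12: "\<not> [u1 = u2] (rmod (2 * pi))"
  let ?I = "time_interval tmax"
  have TI: "T \<in> ?I" using \<open>0 < T\<close> \<open>ereal T < tmax\<close> by (simp add: time_interval_def)
  have sub: "{0..T} \<subseteq> ?I" using TI by (rule atLeastAtMost_subset_time_interval)
  have per: "periodic_fun_simple (\<lambda>u. X u s) (2 * pi)" and C2: "C2_curve (\<lambda>u. X u s)"
    and reg: "regular_curve (\<lambda>u. X u s)"
    and dt: "((\<lambda>r. X u r) has_vector_derivative curvature_vector (\<lambda>v. X v s) u) (at s within ?I)"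
    if "s \<in> ?I" for s u
    using flow that unfolding curve_shortening_flow_def by blast+
  have C1: "C1_space_time X ?I" and X0: "\<And>u. X u 0 = X0 u"
    using flow unfolding curve_shortening_flow_def by blast+
  note cont = C1_space_time_continuous_on[OF C1 convex_time_interval]

  obtain x r where sphere0: "\<And>u. norm (X0 u - x) = r"
    using spherical unfolding spherical_def by (metis norm_minus_commute rangeI)
  note sphere = curve_shortening_flow_sphere[OF flow sphere0]
  \<comment> \<open>A regular curve cannot lie on a sphere of radius zero: on a sphere every point
    is both a minimum and a maximum of the distance to \<open>x\<close>, which forces
    \<open>?y \<bullet> ?k = -1\<close>.\<close>
  have radius: "r\<^sup>2 - 2 * T > 0"
  proof -
    let ?y = "X 0 T - x" and ?k = "curvature_vector (\<lambda>v. X v T) 0"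
    have "c * (?y \<bullet> ?k + 1) \<ge> 0" for c
      using sphere[OF TI] by (intro curvature_vector_at_distance_extremum C2 reg TI) simp
    from this[of 1] this[of "-1"] have "?y \<bullet> ?k = -1" by simp
    then have "?y \<noteq> 0" by auto
    then show ?thesis using sphere[OF TI, of 0] by (metis zero_less_norm_iff zero_less_power)
  qed

  \<comment> \<open>Pairs are written \<open>u\<close>, \<open>u + v\<close> with both
    \<open>u\<close> and \<open>v\<close> in \<open>{0..2 * pi}\<close>, hence the range up to
    \<open>4 * pi\<close>.\<close>
  obtain a \<delta>0 where "a > 0" "\<delta>0 > 0" and chord:
    "\<And>u v t. \<lbrakk>u \<in> {0..4 * pi}; v \<in> {0..4 * pi}; t \<in> {0..T}; \<bar>v - u\<bar> < \<delta>0\<rbrakk>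
      \<Longrightarrow> a * \<bar>v - u\<bar> \<le> norm (X v t - X u t)"
    using C1_space_time_chord_bound[OF C1 reg sub compact_Icc] by metis
  \<comment> \<open>Halving makes gaps equal to \<open>\<delta>\<close> admissible in
    \<open>chord\<close>; the bound by \<open>pi\<close> keeps
    \<open>{\<delta>..2 * pi - \<delta>}\<close> nonempty.\<close>
  define \<delta> where "\<delta> = min (\<delta>0 / 2) pi"
  have \<delta>: "0 < \<delta>" "\<delta> < \<delta>0" "\<delta> \<le> pi" using \<open>\<delta>0 > 0\<close> by (auto simp: \<delta>_def min_def)
  have near: "a * v \<le> norm (X u t - X (u + v) t)"
    if "u \<in> {0..2 * pi}" "0 \<le> v" "v \<le> \<delta>" "t \<in> {0..T}" for u v t
    using chord[of u "u + v" t] that \<delta> by (simp add: norm_minus_commute)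
  \<comment> \<open>A gap near a full period is short on the circle: \<open>u + v\<close> is
    compared with \<open>u + 2 * pi\<close>.\<close>
  have far: "a * (2 * pi - v) \<le> norm (X u t - X (u + v) t)"
    if "u \<in> {0..2 * pi}" "2 * pi - \<delta> \<le> v" "v \<le> 2 * pi" "t \<in> {0..T}" for u v t
  proof -
    interpret periodic_fun_simple "\<lambda>u. X u t" "2 * pi"
      using per sub that by blast
    show ?thesis
      using chord[of "u + v" "u + 2 * pi" t] that \<delta> plus_period[of u] by simp
  qed

  \<comment> \<open>Pairs are given by first parameter and gap, so only the two extreme gaps form a
    genuine boundary, and there the chord bounds apply.\<close>
  define K where "K = {0..2 * pi} \<times> {\<delta>..2 * pi - \<delta>}"
  define g where "g = (\<lambda>z s. (norm (X (fst z) s - X (fst z + snd z) s))\<^sup>2)"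
  have "compact K" unfolding K_def by (intro compact_Times) auto
  have "(0, \<delta>) \<in> K" using \<delta> by (simp add: K_def)
  have cX: "continuous_on S (\<lambda>z. X (p z) (q z))"
    if "continuous_on S p" "continuous_on S q" "\<And>z. z \<in> S \<Longrightarrow> q z \<in> {0..T}"
    for p q and S :: "'b::topological_space set"
  proof -
    have "continuous_on S (\<lambda>z. (p z, q z))" using that by (intro continuous_intros)
    moreover have "(\<lambda>z. (p z, q z)) ` S \<subseteq> UNIV \<times> ?I" using that sub by auto
    ultimately show ?thesis
      using continuous_on_compose2[OF cont] by fastforce
  qed
  have "continuous_on K (\<lambda>z. g z 0)"
    unfolding g_def using \<open>0 < T\<close> by (intro continuous_intros cX) auto
  from continuous_attains_inf[OF \<open>compact K\<close> _ this] \<open>(0, \<delta>) \<in> K\<close>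
  obtain z0 where z0: "z0 \<in> K" "\<And>z. z \<in> K \<Longrightarrow> g z0 0 \<le> g z 0" by blast
  have "g z0 0 > 0"
  proof -
    have "X0 (fst z0) \<noteq> X0 (fst z0 + snd z0)"
    proof
      assume "X0 (fst z0) = X0 (fst z0 + snd z0)"
      then have "[fst z0 = fst z0 + snd z0] (rmod (2 * pi))"
        using simple by (simp add: simple_on_circle_def)
      from rcong_imp_eq[OF this] show False
        using z0(1) \<delta> by (auto simp: K_def)
    qed
    then show ?thesis by (simp add: g_def X0)
  qed
  \<comment> \<open>The three entries are the least initial squared distance on \<open>K\<close>,
    the squared chord bound at the extreme gaps, and the squared diameter of the smallest sphere,
    reached at time \<open>T\<close>.\<close>
  define m where "m = min (g z0 0) (min ((a * \<delta>)\<^sup>2) (4 * (r\<^sup>2 - 2 * T)))"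
  have "m > 0" using \<open>g z0 0 > 0\<close> \<open>a > 0\<close> \<delta> radius by (simp add: m_def)

  have ge: "m - g z T \<le> 0" if "z \<in> K" for z
  proof (rule weak_maximum_principle[where K = K and T = T and F = "\<lambda>z s. m - g z s"])
    show "continuous_on (K \<times> {0..T}) (\<lambda>(z, s). m - g z s)"
      unfolding g_def case_prod_unfold by (intro continuous_intros cX) auto
    show "m - g z 0 \<le> 0" if "z \<in> K" for z
      using z0(2)[OF that] by (simp add: m_def)
    fix z s
    assume z: "z \<in> K" and s: "0 < s" "s \<le> T" and pos: "m - g z s > 0"
      and max: "\<And>l. l \<in> K \<Longrightarrow> m - g l s \<le> m - g z s"
    obtain u v where uv: "z = (u, v)" by (cases z)
    have sI: "s \<in> ?I" and sT: "s \<in> {0..T}" and sub': "{0..s} \<subseteq> ?I" using s sub by auto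
    have u: "u \<in> {0..2 * pi}" and v: "\<delta> \<le> v" "v \<le> 2 * pi - \<delta>" using z uv by (auto simp: K_def)
    let ?\<gamma> = "\<lambda>u. X u s" and ?w = "X u s - X (u + v) s"
    have small: "(norm ?w)\<^sup>2 < m" using pos by (simp add: g_def uv)
    \<comment> \<open>The second entry of \<open>m\<close> keeps the minimizing pair away from the
      extreme gaps.\<close>
    have "norm ?w < a * \<delta>"
      using small \<open>a > 0\<close> \<delta> by (simp add: m_def power2_less_imp_less)
    then have v': "\<delta> < v" "v < 2 * pi - \<delta>"
      using near[OF u _ _ sT, of v] far[OF u _ _ sT, of v] v \<delta>
      by (smt (verit, best))+
    \<comment> \<open>The third entry excludes antipodal points, the sphere at time \<open>s\<close>
      being at least as large as that at \<open>T\<close>.\<close>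
    have "norm ?w < sqrt (4 * (r\<^sup>2 - 2 * s))"
      using small s by (intro real_less_rsqrt) (auto simp: m_def)
    then have lt: "norm ?w < 2 * sqrt (r\<^sup>2 - 2 * s)"
      unfolding real_sqrt_mult by simp
    \<comment> \<open>Moving both endpoints by less than \<open>d\<close> changes the gap by less
      than \<open>2 * d\<close>, which stays admissible.\<close>
    define d where "d = min (v - \<delta>) (2 * pi - \<delta> - v) / 2"
    have "d > 0" and d: "2 * d \<le> v - \<delta>" "2 * d \<le> 2 * pi - \<delta> - v"
      using v' by (auto simp: d_def)
    have min: "norm ?w \<le> norm (X u' s - X v' s)"
      if "\<bar>u' - u\<bar> < d" "\<bar>v' - (u + v)\<bar> < d" for u' v'
    proof -
      \<comment> \<open>Wrapping the first parameter around the circle makes the local minimum valid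
        across the ends of the parameter range of \<open>u\<close>.\<close>
      let ?z = "(u' rmod (2 * pi), v' - u')"
      have "\<delta> \<le> v' - u'" "v' - u' \<le> 2 * pi - \<delta>" using that d by linarith+
      then have "?z \<in> K"
        using rmod_nonneg[of "2 * pi" u'] rmod_le[of "2 * pi" u'] by (simp add: K_def)
      from max[OF this] have "g z s \<le> g ?z s" by simp
      also have "g ?z s = (norm (X u' s - X v' s))\<^sup>2"
        using periodic_fun_simple_rmod_add[OF per[OF sI], of u' 0]
          periodic_fun_simple_rmod_add[OF per[OF sI], of u' "v' - u'"]
        by (simp add: g_def)
      finally show ?thesis
        by (simp add: g_def uv)
    qed
    have "norm (X y s - x) = sqrt (r\<^sup>2 - 2 * s)" for y
      using sphere[OF sI] by (metis norm_ge_zero real_sqrt_unique)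
    from curvature_vector_at_local_min_distance[OF _ C2[OF sI] reg[OF sI] this \<open>d > 0\<close> min lt]
    have "?w \<bullet> (curvature_vector ?\<gamma> u - curvature_vector ?\<gamma> (u + v)) \<ge> 0"
      by simp
    moreover have "((\<lambda>r. X u r - X (u + v) r) has_vector_derivative
        curvature_vector ?\<gamma> u - curvature_vector ?\<gamma> (u + v)) (at s within {0..s})"
      by (intro has_vector_derivative_diff has_vector_derivative_within_subset[OF dt[OF sI] sub'])
    from bounded_bilinear.has_vector_derivative[OF bounded_bilinear_inner this this]
    have "(g z has_real_derivative
        2 * (?w \<bullet> (curvature_vector ?\<gamma> u - curvature_vector ?\<gamma> (u + v)))) (at s within {0..s})"
      unfolding g_def uv
      by (simp add: has_real_derivative_iff_has_vector_derivative inner_commute power2_norm_eq_inner)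
    then have "((\<lambda>s. m - g z s) has_real_derivative
        - (2 * (?w \<bullet> (curvature_vector ?\<gamma> u - curvature_vector ?\<gamma> (u + v))))) (at s within {0..s})"
      by (auto intro!: derivative_eq_intros)
    ultimately show "\<exists>D\<le>0. ((\<lambda>s. m - g z s) has_real_derivative D) (at s within {0..s})"
      by (intro exI conjI) auto
  qed (use \<open>compact K\<close> \<open>0 < T\<close> that in auto)

  \<comment> \<open>An arbitrary pair is normalised to first parameter and gap; \<open>v\<close> is
    nonzero because the two parameters are not congruent.\<close>
  define u v where "u = u1 rmod (2 * pi)" and "v = (u2 - u1) rmod (2 * pi)"
  have u: "u \<in> {0..2 * pi}" and v: "0 \<le> v" "v < 2 * pi"
    using rmod_nonneg[of "2 * pi"] rmod_le[of "2 * pi"] rmod_less[of "2 * pi"] by (auto simp: u_def v_def)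
  have "v \<noteq> 0"
    using u12 rcong_conv_diff_rmod_eq_0[of u2 u1] by (simp add: v_def rcong_sym_iff)
  have "X u1 T = X u T" "X u2 T = X (u + v) T"
    using periodic_fun_simple_rmod_add[OF per[OF TI], of u1 0]
      periodic_fun_simple_rmod_add[OF per[OF TI], of u1 v]
      periodic_fun_simple_rmod_add[OF per[OF TI], of "u2 - u1" u1]
    by (simp_all add: u_def v_def add.commute)
  moreover have "norm (X u T - X (u + v) T) > 0"
  proof -
    consider "v \<le> \<delta>" | "2 * pi - \<delta> \<le> v" | "(u, v) \<in> K" using u by (force simp: K_def)
    then show ?thesis
    proof cases
      case 1
      have "0 < a * v" using \<open>a > 0\<close> v \<open>v \<noteq> 0\<close> by simp
      also have "a * v \<le> norm (X u T - X (u + v) T)"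
        using near[OF u] 1 v \<open>0 < T\<close> by simp
      finally show ?thesis .
    next
      case 2
      have "0 < a * (2 * pi - v)" using \<open>a > 0\<close> v by simp
      also have "a * (2 * pi - v) \<le> norm (X u T - X (u + v) T)"
        using far[OF u] 2 v \<open>0 < T\<close> by simp
      finally show ?thesis .
    next
      case 3
      then show ?thesis using ge[OF 3] \<open>m > 0\<close> by (auto simp: g_def)
    qed
  qed
  ultimately show "X u1 T \<noteq> X u2 T" by auto
qed

end
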